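(* Let $f(x)\in\mathbb{Z}[x]$ be a monic irreducible polynomial with a complex root $\alpha$ such that $\mathbb{Q}(\alpha)/\mathbb{Q}$ is Galois with group $G$. Let $\chi$ be an absolutely irreducible character of $G$ afforded by a rational matrix representation $A$: there is a minimal left ideal $\mathfrak{m}$ of $\mathbb{Q}[G]c_\chi$ with $\mathbb{Q}$-basis $w_1,\dots,w_{\chi(1)}$ such that $g(w_1,\dots,w_{\chi(1)})=(w_1,\dots,w_{\chi(1)})A(g)$ for all $g\in G$, with $A(g)\in GL_{\chi(1)}(\mathbb{Q})$. Let $v_{i,j}\in\mathbb{Q}[G]c_\chi$ ($1\le i,j\le\chi(1)$) be the elements with $v_{i,j}w_k=\delta_{i,k}w_j$ for all $k$; they form a $\mathbb{Q}$-basis of $\mathbb{Q}[G]c_\chi$. Let $M\in\mathbb{Q}[G]$ satisfy $M=Mc_\chi$ and write $M=\sum_{1\le k,l\le\chi(1)}m_{k,l}v_{l,k}$ with $m_{k,l}\in\mathbb{Q}$. Then $M\in LR(\chi)$ holds if and only if $$(m_{i,j})\Big(\sum_{g\in G}g^{-1}(\alpha)A(g)\Big)=0,$$ and this is moreover equivalent to the vanishing of the product of the matrix $(m_{i,j})$ with the first column of $\sum_{g\in G}g^{-1}(\alpha)A(g)$.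
   Context: $c_\chi:=\chi(1)|G|^{-1}\sum_{g\in G}\overline{\chi(g)}g\in\mathbb{Q}[G]$ (here $\chi$ is rational-valued). $LR(\chi):=\{M\in\mathbb{Q}[G]\mid M=Mc_\chi,\ M\cdot(\sum_{g\in G}g(\alpha)g^{-1})=0\}$, the product taken in the group algebra $\mathbb{C}[G]$. For $g\in G$, $g^{-1}(\alpha)$ is the image of $\alpha$ under the field automorphism $g^{-1}$. *)

theory Defs
  imports
    Complex_Main
    "HOL-Algebra.Bij"
    "HOL-Algebra.AbelCoset"
    "HOL-Algebra.Generated_Fields"
    "HOL-Computational_Algebra.Polynomial_Factorial"
    "Jordan_Normal_Form.VS_Connect"
begin

definition adjoin_rat :: "complex \<Rightarrow> complex set" where
  "adjoin_rat \<alpha> = generate_field class_ring (insert \<alpha> \<rat>)"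

text \<open>
  A subfield \<open>K\<close> of the complex numbers is Galois over the rationals if it is algebraic, normal
  and separable: every irreducible rational polynomial with a root in \<open>K\<close> is a product of
  pairwise distinct linear factors with roots in \<open>K\<close>.
\<close>

definition galois_over_rat :: "complex set \<Rightarrow> bool" where
  "galois_over_rat K \<longleftrightarrow>
     (\<forall>x\<in>K. algebraic x) \<and>
     (\<forall>p :: rat poly. irreducible p \<and> (\<exists>x\<in>K. poly (map_poly of_rat p) x = 0) \<longrightarrow>
        (\<exists>c xs. distinct xs \<and> set xs \<subseteq> K \<and>
           map_poly of_rat p = Polynomial.smult c (\<Prod>x\<leftarrow>xs. [:- x, 1:])))"

definition field_auts :: "complex set \<Rightarrow> (complex \<Rightarrow> complex) set" where
  "field_auts K =
     {\<sigma> \<in> Bij K. (\<forall>x\<in>K. \<forall>y\<in>K. \<sigma> (x + y) = \<sigma> x + \<sigma> y \<and> \<sigma> (x * y) = \<sigma> x * \<sigma> y) \<and>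
                 (\<forall>q\<in>\<rat>. \<sigma> q = q)}"

definition galois_group :: "complex set \<Rightarrow> (complex \<Rightarrow> complex) monoid" where
  "galois_group K = (BijGroup K)\<lparr>carrier := field_auts K\<rparr>"

text \<open>
  The group algebra of a finite group \<open>G\<close> with coefficients in a subfield \<open>K\<close> of the complex
  numbers; the element \<open>\<Sum>g. a\<^sub>g g\<close> is the function \<open>g \<mapsto> a\<^sub>g\<close>, extended by zero outside
  \<open>carrier G\<close>. In this way \<open>\<rat>[G]\<close> is literally a subring of \<open>\<complex>[G]\<close>.
\<close>

definition group_algebra :: "complex set \<Rightarrow> ('g, 'z) monoid_scheme \<Rightarrow> ('g \<Rightarrow> complex) ring" where
  "group_algebra K G =
     \<lparr>carrier = {a. (\<forall>g \<in> carrier G. a g \<in> K) \<and> (\<forall>g. g \<notin> carrier G \<longrightarrow> a g = 0)},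
      mult = (\<lambda>a b x. if x \<in> carrier G
                then \<Sum>y \<in> carrier G. a y * b (inv\<^bsub>G\<^esub> y \<otimes>\<^bsub>G\<^esub> x) else 0),
      one = (\<lambda>x. if x = \<one>\<^bsub>G\<^esub> then 1 else 0),
      zero = (\<lambda>x. 0),
      add = (\<lambda>a b x. a x + b x)\<rparr>"

abbreviation rat_group_algebra :: "('g, 'z) monoid_scheme \<Rightarrow> ('g \<Rightarrow> complex) ring" where
  "rat_group_algebra G \<equiv> group_algebra \<rat> G"

abbreviation complex_group_algebra :: "('g, 'z) monoid_scheme \<Rightarrow> ('g \<Rightarrow> complex) ring" where
  "complex_group_algebra G \<equiv> group_algebra UNIV G"

definition group_elt :: "'g \<Rightarrow> 'g \<Rightarrow> complex" where
  "group_elt g = (\<lambda>x. if x = g then 1 else 0)"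

definition lin_comb :: "'i set \<Rightarrow> ('i \<Rightarrow> complex) \<Rightarrow> ('i \<Rightarrow> 'g \<Rightarrow> complex) \<Rightarrow> 'g \<Rightarrow> complex" where
  "lin_comb I c b = (\<lambda>x. \<Sum>i\<in>I. c i * b i x)"

definition rat_basis :: "'i set \<Rightarrow> ('i \<Rightarrow> 'g \<Rightarrow> complex) \<Rightarrow> ('g \<Rightarrow> complex) set \<Rightarrow> bool" where
  "rat_basis I b V \<longleftrightarrow>
     V = {lin_comb I (\<lambda>i. of_rat (c i)) b | c :: 'i \<Rightarrow> rat. True} \<and>
     (\<forall>c :: 'i \<Rightarrow> rat. lin_comb I (\<lambda>i. of_rat (c i)) b = (\<lambda>x. 0) \<longrightarrow> (\<forall>i\<in>I. c i = 0))"

definition left_ideal :: "'a set \<Rightarrow> ('a, 'z) ring_scheme \<Rightarrow> bool" where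
  "left_ideal I R \<longleftrightarrow>
     additive_subgroup I R \<and> (\<forall>r \<in> carrier R. \<forall>x\<in>I. r \<otimes>\<^bsub>R\<^esub> x \<in> I)"

definition minimal_left_ideal :: "'a set \<Rightarrow> ('a, 'z) ring_scheme \<Rightarrow> bool" where
  "minimal_left_ideal I R \<longleftrightarrow>
     left_ideal I R \<and> I \<noteq> {\<zero>\<^bsub>R\<^esub>} \<and>
     (\<forall>J. left_ideal J R \<and> J \<subseteq> I \<and> J \<noteq> {\<zero>\<^bsub>R\<^esub>} \<longrightarrow> J = I)"

definition GL :: "nat \<Rightarrow> 'k :: field mat monoid" where
  "GL n = units_of (ring_mat TYPE('k) n ())"

definition mat_trace :: "'k :: field mat \<Rightarrow> 'k" where
  "mat_trace A = (\<Sum>i < dim_row A. A $$ (i, i))"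

definition irreducible_rep :: "('g, 'z) monoid_scheme \<Rightarrow> nat \<Rightarrow> ('g \<Rightarrow> 'k :: field mat) \<Rightarrow> bool" where
  "irreducible_rep G n B \<longleftrightarrow>
     n > 0 \<and> B \<in> hom G (GL n) \<and>
     (\<forall>W. subspace class_ring W (module_vec TYPE('k) n) \<and>
          (\<forall>g \<in> carrier G. \<forall>x\<in>W. B g *\<^sub>v x \<in> W) \<longrightarrow>
          W = {0\<^sub>v n} \<or> W = carrier_vec n)"

text \<open>
  Absolute irreducibility is irreducibility over the algebraically closed field \<open>\<complex>\<close>.
\<close>

definition absolutely_irreducible_character ::
    "('g, 'z) monoid_scheme \<Rightarrow> ('g \<Rightarrow> complex) \<Rightarrow> bool" where
  "absolutely_irreducible_character G \<chi> \<longleftrightarrow>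
     (\<exists>n (B :: 'g \<Rightarrow> complex mat). irreducible_rep G n B \<and>
        (\<forall>g \<in> carrier G. \<chi> g = mat_trace (B g)))"

definition central_idem :: "('g, 'z) monoid_scheme \<Rightarrow> ('g \<Rightarrow> complex) \<Rightarrow> 'g \<Rightarrow> complex" where
  "central_idem G \<chi> =
     lin_comb (carrier G) (\<lambda>g. \<chi> \<one>\<^bsub>G\<^esub> / of_nat (Coset.order G) * cnj (\<chi> g)) group_elt"

text \<open>The ring \<open>\<rat>[G]c\<^sub>\<chi>\<close>, whose unit is \<open>c\<^sub>\<chi>\<close>.\<close>

definition block_algebra ::
    "('g, 'z) monoid_scheme \<Rightarrow> ('g \<Rightarrow> complex) \<Rightarrow> ('g \<Rightarrow> complex) ring" where
  "block_algebra G \<chi> = (rat_group_algebra G)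
     \<lparr>carrier := {a \<otimes>\<^bsub>rat_group_algebra G\<^esub> central_idem G \<chi> | a. a \<in> carrier (rat_group_algebra G)},
      one := central_idem G \<chi>\<rparr>"

definition LR :: "(complex \<Rightarrow> complex) monoid \<Rightarrow> complex \<Rightarrow>
    ((complex \<Rightarrow> complex) \<Rightarrow> complex) \<Rightarrow> ((complex \<Rightarrow> complex) \<Rightarrow> complex) set" where
  "LR G \<alpha> \<chi> =
     {M \<in> carrier (rat_group_algebra G).
        M = M \<otimes>\<^bsub>rat_group_algebra G\<^esub> central_idem G \<chi> \<and>
        M \<otimes>\<^bsub>complex_group_algebra G\<^esub>
          lin_comb (carrier G) (\<lambda>g. g \<alpha>) (\<lambda>g. group_elt (inv\<^bsub>G\<^esub> g))
        = \<zero>\<^bsub>complex_group_algebra G\<^esub>}"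

text \<open>The matrix \<open>\<Sum>g. g\<^sup>-\<^sup>1(\<alpha>) A(g)\<close>, summed entrywise.\<close>

definition conjugate_sum_mat :: "(complex \<Rightarrow> complex) monoid \<Rightarrow> complex \<Rightarrow> nat \<Rightarrow>
    ((complex \<Rightarrow> complex) \<Rightarrow> rat mat) \<Rightarrow> complex mat" where
  "conjugate_sum_mat G \<alpha> n A =
     mat n n (\<lambda>(i, j). \<Sum>g \<in> carrier G. (inv\<^bsub>G\<^esub> g) \<alpha> * of_rat (A g $$ (i, j)))"

end

theory Submission
  imports Defs
begin

text \<open>
  Extend \<open>A\<close> linearly to \<open>\<rho>(a) = \<Sum>g. a(g) A(g)\<close> on \<open>\<complex>[G]\<close>. Comparing actions on the \<open>w\<^sub>k\<close> shows
  that \<open>\<rho>(v\<^sub>i\<^sub>j)\<close> is the matrix unit \<open>E\<^sub>j\<^sub>i\<close>, so \<open>\<rho>(M) = (m\<^sub>i\<^sub>j)\<close> and, with \<open>\<theta> = \<Sum>g. g\<^sup>-\<^sup>1(\<alpha>) g\<close>,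
  \<open>\<rho>(M \<theta>)\<close> is the matrix product of the theorem. Because \<open>c\<^sub>\<chi>\<close> is central, \<open>M \<theta> = (M \<theta>) c\<^sub>\<chi>\<close>, and the
  coefficient of \<open>x\<close> in \<open>a c\<^sub>\<chi>\<close> is a multiple of the trace of \<open>A(x\<^sup>-\<^sup>1) \<rho>(a)\<close>; hence \<open>\<rho>(M \<theta>) = 0\<close>
  forces \<open>M \<theta> = 0\<close>. The same argument shows that the \<open>v\<^sub>i\<^sub>j\<close> span. For the first column,
  \<open>h(\<rho>(\<theta>)) = \<rho>(\<theta>) A(h)\<close> for \<open>h \<in> G\<close>, and the vectors \<open>A(h) e\<^sub>0\<close> span.
\<close>

section \<open>Entries and traces of matrix products\<close>

lemma mult_mat_entry:
  assumes "P \<in> carrier_mat n n" "Q \<in> carrier_mat n n" "i < n" "j < n"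
  shows "(P * Q) $$ (i, j) = (\<Sum>k<n. P $$ (i, k) * Q $$ (k, j))"
  using assms by (auto simp: scalar_prod_def atLeast0LessThan intro!: sum.cong)

lemma mat_trace_mult_comm:
  fixes P Q :: "'k :: field mat"
  assumes "P \<in> carrier_mat n n" "Q \<in> carrier_mat n n"
  shows "mat_trace (P * Q) = mat_trace (Q * P)"
proof -
  have "mat_trace (P * Q) = (\<Sum>i<n. \<Sum>k<n. P $$ (i, k) * Q $$ (k, i))"
    using assms unfolding mat_trace_def
    by (auto simp: mult_mat_entry[OF assms] simp del: index_mult_mat(1) intro!: sum.cong)
  also have "\<dots> = (\<Sum>k<n. \<Sum>i<n. Q $$ (k, i) * P $$ (i, k))"
    by (subst sum.swap) (simp add: mult.commute)
  also have "\<dots> = mat_trace (Q * P)"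
    using assms unfolding mat_trace_def
    by (auto simp: mult_mat_entry[OF assms(2,1)] simp del: index_mult_mat(1) intro!: sum.cong)
  finally show ?thesis .
qed

lemma cnj_of_rat [simp]: "cnj (of_rat q) = of_rat q"
  by (cases q) (simp add: of_rat_rat)

section \<open>Convolution as the product of the group algebra\<close>

context group
begin

text \<open>The coefficient field does not enter the product of \<open>group_algebra K G\<close>, so
  one operation on functions serves \<open>\<rat>[G]\<close> and \<open>\<complex>[G]\<close>
  alike.\<close>

definition conv :: "('a \<Rightarrow> complex) \<Rightarrow> ('a \<Rightarrow> complex) \<Rightarrow> 'a \<Rightarrow> complex" where
  "conv a b = (\<lambda>x. if x \<in> carrier G then \<Sum>y\<in>carrier G. a y * b (inv y \<otimes> x) else 0)"

lemma mult_group_algebra: "mult (group_algebra K G) = conv"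
  by (simp add: group_algebra_def conv_def fun_eq_iff)

lemma sum_left_translate:
  assumes "y \<in> carrier G"
  shows "(\<Sum>x\<in>carrier G. f (y \<otimes> x)) = sum f (carrier G)"
  by (rule sum.reindex_bij_witness[of _ "\<lambda>x. inv y \<otimes> x" "\<lambda>x. y \<otimes> x"])
     (use assms in \<open>auto simp: m_assoc[symmetric]\<close>)

lemma sum_right_translate:
  assumes "y \<in> carrier G"
  shows "(\<Sum>x\<in>carrier G. f (x \<otimes> y)) = sum f (carrier G)"
  by (rule sum.reindex_bij_witness[of _ "\<lambda>x. x \<otimes> inv y" "\<lambda>x. x \<otimes> y"])
     (use assms in \<open>auto simp: m_assoc\<close>)

lemma conv_assoc: "conv (conv a b) c = conv a (conv b c)"
proof
  fix x
  show "conv (conv a b) c x = conv a (conv b c) x"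
  proof (cases "x \<in> carrier G")
    case True
    have "conv (conv a b) c x =
        (\<Sum>y\<in>carrier G. \<Sum>z\<in>carrier G. a z * b (inv z \<otimes> y) * c (inv y \<otimes> x))"
      using True by (simp add: conv_def sum_distrib_right)
    also have "\<dots> = (\<Sum>z\<in>carrier G. \<Sum>y\<in>carrier G. a z * b (inv z \<otimes> y) * c (inv y \<otimes> x))"
      by (rule sum.swap)
    also have "\<dots> = (\<Sum>z\<in>carrier G. \<Sum>u\<in>carrier G.
                     a z * b (inv z \<otimes> (z \<otimes> u)) * c (inv (z \<otimes> u) \<otimes> x))"
      by (intro sum.cong refl sum_left_translate[symmetric])
    also have "\<dots> = (\<Sum>z\<in>carrier G. \<Sum>u\<in>carrier G. a z * (b u * c (inv u \<otimes> (inv z \<otimes> x))))"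
      using True by (intro sum.cong refl)
        (simp add: m_assoc[symmetric] inv_mult_group)
    also have "\<dots> = conv a (conv b c) x"
      using True by (simp add: conv_def sum_distrib_left)
    finally show ?thesis .
  qed (simp add: conv_def)
qed

text \<open>Replacing \<open>y\<close> by \<open>x \<otimes> inv y\<close> in the right-hand sum
  leaves \<open>c (inv y \<otimes> x)\<close> to be compared with
  \<open>c (x \<otimes> inv y)\<close>, which the hypothesis identifies. This is what makes
  \<open>central_idem\<close> central.\<close>

lemma conv_class_function_comm:
  assumes "\<And>x y. x \<in> carrier G \<Longrightarrow> y \<in> carrier G \<Longrightarrow> c (x \<otimes> y) = c (y \<otimes> x)"
  shows "conv a c = conv c a"
proof
  fix x
  show "conv a c x = conv c a x"
  proof (cases "x \<in> carrier G")
    case True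
    have "(\<Sum>y\<in>carrier G. a y * c (inv y \<otimes> x)) = (\<Sum>y\<in>carrier G. c y * a (inv y \<otimes> x))"
      by (rule sum.reindex_bij_witness[of _ "\<lambda>z. inv z \<otimes> x" "\<lambda>y. x \<otimes> inv y"])
         (use True assms in \<open>auto simp: m_assoc inv_mult_group, auto simp: m_assoc[symmetric]\<close>)
    then show ?thesis using True by (simp add: conv_def)
  qed (simp add: conv_def)
qed

lemma conv_lin_comb_left: "conv (lin_comb I c b) d = lin_comb I c (\<lambda>i. conv (b i) d)"
  unfolding conv_def lin_comb_def
  by (auto simp: fun_eq_iff sum_distrib_right sum_distrib_left mult.assoc intro: sum.swap)

text \<open>Reduces the left action of an arbitrary element to that of group elements, where the
  matrices \<open>A g\<close> are available.\<close>

lemma conv_as_sum_of_translates: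
  assumes "finite (carrier G)"
  shows "conv a b x = (\<Sum>g\<in>carrier G. a g * conv (group_elt g) b x)"
  using assms by (auto simp: conv_def group_elt_def of_bool_def if_distrib[of "\<lambda>u. u * _"] sum.delta
      intro!: sum.cong cong: if_cong)

end

section \<open>Rational matrix representations and traces at inverses\<close>

locale rat_matrix_rep = group G for G (structure) +
  fixes n :: nat and A :: "'a \<Rightarrow> rat mat"
  assumes finite_carrier: "finite (carrier G)"
    and rep_carrier: "g \<in> carrier G \<Longrightarrow> A g \<in> carrier_mat n n"
    and rep_mult: "g \<in> carrier G \<Longrightarrow> h \<in> carrier G \<Longrightarrow> A (g \<otimes> h) = A g * A h"
    and rep_one: "A \<one> = 1\<^sub>m n"
begin

lemma rep_mult_entry:
  assumes "g \<in> carrier G" "h \<in> carrier G" "i < n" "j < n"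
  shows "A (g \<otimes> h) $$ (i, j) = (\<Sum>k<n. A g $$ (i, k) * A h $$ (k, j))"
  unfolding rep_mult[OF assms(1,2)] using assms by (intro mult_mat_entry rep_carrier)

text \<open>
  The form \<open>\<Sum>h. A(h)\<^sup>T A(h)\<close> is invariant and positive definite over \<open>\<rat>\<close>, so \<open>A(g\<^sup>-\<^sup>1)\<close> is conjugate
  to \<open>A(g)\<^sup>T\<close>. This replaces the eigenvalue argument for \<open>\<chi>(g\<^sup>-\<^sup>1) = cnj (\<chi> g)\<close>.
\<close>

definition invariant_form :: "rat mat" where
  "invariant_form = mat n n (\<lambda>(i, j). \<Sum>h\<in>carrier G. \<Sum>k<n. A h $$ (k, i) * A h $$ (k, j))"

lemma invariant_form_carrier: "invariant_form \<in> carrier_mat n n"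
  by (simp add: invariant_form_def)

text \<open>Replacing the summation variable \<open>h\<close> by \<open>h \<otimes> inv g\<close>
  moves \<open>g\<close> from the right factor of each summand to an inverse in the left
  one.\<close>

lemma invariant_form_adjoint:
  assumes "g \<in> carrier G"
  shows "invariant_form * A g = transpose_mat (A (inv g)) * invariant_form"
proof (rule eq_matI)
  note car = rep_carrier[OF assms] rep_carrier[OF inv_closed[OF assms]] invariant_form_carrier
  fix i j assume "i < dim_row (transpose_mat (A (inv g)) * invariant_form)"
    "j < dim_col (transpose_mat (A (inv g)) * invariant_form)"
  then have ij: "i < n" "j < n" using car by auto
  have "(invariant_form * A g) $$ (i, j) =
      (\<Sum>l<n. \<Sum>h\<in>carrier G. \<Sum>k<n. A h $$ (k, i) * (A h $$ (k, l) * A g $$ (l, j)))"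
    unfolding mult_mat_entry[OF car(3,1) ij]
    using ij by (simp add: invariant_form_def sum_distrib_right mult.assoc)
  also have "\<dots> = (\<Sum>h\<in>carrier G. \<Sum>k<n. \<Sum>l<n. A h $$ (k, i) * (A h $$ (k, l) * A g $$ (l, j)))"
    by (subst sum.swap, intro sum.cong refl sum.swap)
  also have "\<dots> = (\<Sum>h\<in>carrier G. \<Sum>k<n. A h $$ (k, i) * A (h \<otimes> g) $$ (k, j))"
    using ij assms by (simp add: rep_mult_entry sum_distrib_left)
  also have "\<dots> = (\<Sum>h\<in>carrier G. \<Sum>k<n. A (h \<otimes> inv g) $$ (k, i) * A (h \<otimes> inv g \<otimes> g) $$ (k, j))"
    using assms by (intro sum_right_translate[symmetric]) simp
  also have "\<dots> = (\<Sum>h\<in>carrier G. \<Sum>k<n. A (h \<otimes> inv g) $$ (k, i) * A h $$ (k, j))"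
    using assms by (intro sum.cong refl) (simp add: m_assoc)
  also have "\<dots> = (\<Sum>h\<in>carrier G. \<Sum>k<n. \<Sum>l<n. A (inv g) $$ (l, i) * (A h $$ (k, l) * A h $$ (k, j)))"
    using ij assms by (intro sum.cong refl)
      (simp add: rep_mult_entry sum_distrib_left sum_distrib_right mult_ac)
  also have "\<dots> = (\<Sum>l<n. \<Sum>h\<in>carrier G. \<Sum>k<n. A (inv g) $$ (l, i) * (A h $$ (k, l) * A h $$ (k, j)))"
    by (subst (2) sum.swap, subst sum.swap, intro sum.cong refl)
  also have "\<dots> = (transpose_mat (A (inv g)) * invariant_form) $$ (i, j)"
    using ij car
    by (subst mult_mat_entry[of _ n]) (auto simp: invariant_form_def sum_distrib_left)
  finally show "(invariant_form * A g) $$ (i, j) = (transpose_mat (A (inv g)) * invariant_form) $$ (i, j)" .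
qed (use rep_carrier[OF assms] rep_carrier[OF inv_closed[OF assms]] invariant_form_carrier in auto)

text \<open>For a vector \<open>u\<close> in the kernel, the quadratic form at \<open>u\<close> is a
  sum of rational squares equal to 0. The part with \<open>h = \<one>\<close>, where
  \<open>A \<one>\<close> is the identity, already forces \<open>u = 0\<close>.\<close>

lemma invariant_form_invertible: "\<exists>B. B \<in> carrier_mat n n \<and> invariant_form * B = 1\<^sub>m n \<and> B * invariant_form = 1\<^sub>m n"
proof -
  have "det invariant_form \<noteq> 0"
  proof
    assume "det invariant_form = 0"
    then obtain u where u: "u \<in> carrier_vec n" "u \<noteq> 0\<^sub>v n" "invariant_form *\<^sub>v u = 0\<^sub>v n"
      using det_0_iff_vec_prod_zero_field[OF invariant_form_carrier] by auto
    have "0 = (\<Sum>i<n. u $ i * (invariant_form *\<^sub>v u) $ i)"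
      using u by simp
    also have "\<dots> = (\<Sum>i<n. \<Sum>j<n. \<Sum>h\<in>carrier G. \<Sum>k<n. (A h $$ (k, i) * u $ i) * (A h $$ (k, j) * u $ j))"
      using u(1)
      by (intro sum.cong refl) (simp add: scalar_prod_def atLeast0LessThan invariant_form_def sum_distrib_left
          sum_distrib_right mult_ac)
    also have "\<dots> = (\<Sum>i<n. \<Sum>h\<in>carrier G. \<Sum>k<n. \<Sum>j<n. (A h $$ (k, i) * u $ i) * (A h $$ (k, j) * u $ j))"
      by (intro sum.cong refl, subst sum.swap, intro sum.cong refl sum.swap)
    also have "\<dots> = (\<Sum>h\<in>carrier G. \<Sum>k<n. \<Sum>i<n. \<Sum>j<n. (A h $$ (k, i) * u $ i) * (A h $$ (k, j) * u $ j))"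
      by (subst sum.swap, intro sum.cong refl sum.swap)
    also have "\<dots> = (\<Sum>h\<in>carrier G. \<Sum>k<n. (\<Sum>i<n. A h $$ (k, i) * u $ i)\<^sup>2)"
      by (simp add: power2_eq_square sum_product)
    finally have "(\<Sum>h\<in>carrier G. \<Sum>k<n. (\<Sum>i<n. A h $$ (k, i) * u $ i)\<^sup>2) = 0" by simp
    then have "(\<Sum>k<n. (\<Sum>i<n. A \<one> $$ (k, i) * u $ i)\<^sup>2) = 0"
      by (subst (asm) sum_nonneg_eq_0_iff) (auto simp: finite_carrier sum_nonneg)
    then have "\<forall>k<n. (\<Sum>i<n. A \<one> $$ (k, i) * u $ i) = 0"
      by (subst (asm) sum_nonneg_eq_0_iff) auto
    then have "\<forall>k<n. u $ k = 0"
      by (auto simp: rep_one if_distrib[of "\<lambda>t. t * _"] sum.delta cong: if_cong)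
    then show False using u by auto
  qed
  then have "invariant_form \<in> Units (ring_mat TYPE(rat) n ())"
    by (rule det_non_zero_imp_unit[OF invariant_form_carrier])
  then show ?thesis
    by (auto simp: Units_def ring_mat_simps)
qed

text \<open>With \<open>S\<close> the invariant form and \<open>B\<close> its inverse, the transpose
  of \<open>A (inv g)\<close> is \<open>S * A g * B\<close>; transposition and conjugation preserve
  the trace.\<close>

lemma mat_trace_rep_inv:
  assumes "g \<in> carrier G"
  shows "mat_trace (A (inv g)) = mat_trace (A g)"
proof -
  obtain B where B: "B \<in> carrier_mat n n" "invariant_form * B = 1\<^sub>m n" "B * invariant_form = 1\<^sub>m n"
    using invariant_form_invertible by blast
  note car = rep_carrier[OF assms] rep_carrier[OF inv_closed[OF assms]] invariant_form_carrier
  let ?T = "transpose_mat (A (inv g))"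
  have T: "?T \<in> carrier_mat n n" using car by auto
  have "mat_trace (A (inv g)) = mat_trace ?T"
    using car by (auto simp: mat_trace_def)
  also have "?T = (?T * invariant_form) * B"
    using T B car by (simp add: assoc_mult_mat[of _ n n _ n _ n])
  also have "\<dots> = invariant_form * (A g * B)"
    using T B car by (simp add: invariant_form_adjoint[OF assms, symmetric] assoc_mult_mat[of _ n n _ n _ n])
  also have "mat_trace \<dots> = mat_trace ((A g * B) * invariant_form)"
    using car B by (intro mat_trace_mult_comm[of _ n]) auto
  also have "(A g * B) * invariant_form = A g"
    using B car by (simp add: assoc_mult_mat[of _ n n _ n _ n])
  finally show ?thesis .
qed

lemma mat_trace_rep_comm:
  assumes "g \<in> carrier G" "h \<in> carrier G"
  shows "mat_trace (A (g \<otimes> h)) = mat_trace (A (h \<otimes> g))"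
  using assms by (simp add: rep_mult mat_trace_mult_comm[OF rep_carrier rep_carrier])

section \<open>Linear extension of the representation to the group algebra\<close>

text \<open>Kept as a function of two indices instead of a complex matrix; only indices below
  \<open>n\<close> are meaningful.\<close>

definition rho :: "('a \<Rightarrow> complex) \<Rightarrow> nat \<Rightarrow> nat \<Rightarrow> complex" where
  "rho a i j = (\<Sum>g\<in>carrier G. a g * of_rat (A g $$ (i, j)))"

text \<open>The substitution \<open>x = y \<otimes> z\<close> separates the arguments of
  \<open>a\<close> and \<open>b\<close>, and \<open>A (y \<otimes> z)\<close> splits into a matrix
  product.\<close>

lemma rho_conv:
  assumes "i < n" "j < n"
  shows "rho (conv a b) i j = (\<Sum>k<n. rho a i k * rho b k j)"
proof -
  have "rho (conv a b) i j =
      (\<Sum>x\<in>carrier G. \<Sum>y\<in>carrier G. a y * b (inv y \<otimes> x) * of_rat (A x $$ (i, j)))"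
    by (simp add: rho_def conv_def sum_distrib_right)
  also have "\<dots> = (\<Sum>y\<in>carrier G. \<Sum>x\<in>carrier G. a y * b (inv y \<otimes> x) * of_rat (A x $$ (i, j)))"
    by (rule sum.swap)
  also have "\<dots> = (\<Sum>y\<in>carrier G. \<Sum>z\<in>carrier G.
                     a y * b (inv y \<otimes> (y \<otimes> z)) * of_rat (A (y \<otimes> z) $$ (i, j)))"
    by (intro sum.cong refl sum_left_translate[symmetric])
  also have "\<dots> = (\<Sum>y\<in>carrier G. \<Sum>z\<in>carrier G. \<Sum>k<n.
                     (a y * of_rat (A y $$ (i, k))) * (b z * of_rat (A z $$ (k, j))))"
    using assms by (intro sum.cong refl)
      (simp add: m_assoc[symmetric] rep_mult_entry of_rat_sum of_rat_mult sum_distrib_left mult_ac)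
  also have "\<dots> = (\<Sum>y\<in>carrier G. \<Sum>k<n. \<Sum>z\<in>carrier G.
                     (a y * of_rat (A y $$ (i, k))) * (b z * of_rat (A z $$ (k, j))))"
    by (intro sum.cong refl sum.swap)
  also have "\<dots> = (\<Sum>k<n. \<Sum>y\<in>carrier G. \<Sum>z\<in>carrier G.
                     (a y * of_rat (A y $$ (i, k))) * (b z * of_rat (A z $$ (k, j))))"
    by (rule sum.swap)
  also have "\<dots> = (\<Sum>k<n. rho a i k * rho b k j)"
    by (simp add: rho_def sum_product)
  finally show ?thesis .
qed

lemma rho_lin_comb: "rho (lin_comb I c b) i j = (\<Sum>t\<in>I. c t * rho (b t) i j)"
  by (simp add: rho_def lin_comb_def sum_distrib_left sum_distrib_right mult.assoc)
     (rule sum.swap)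


text \<open>Linear independence of \<open>w\<close> is assumed over \<open>\<rat>\<close> only, so
  coefficients must be seen to be rational before they are compared.\<close>

lemma rho_rat:
  assumes "\<forall>g\<in>carrier G. a g \<in> \<rat>"
  shows "rho a i j \<in> \<rat>"
  using assms by (auto simp: rho_def intro!: Rats_sum Rats_mult)

end

section \<open>The block algebra and its matrix units\<close>

lemma (in group) central_idem_apply:
  assumes "finite (carrier G)"
  shows "central_idem G \<chi> x =
    (if x \<in> carrier G then \<chi> \<one> / of_nat (Coset.order G) * cnj (\<chi> x) else 0)"
  using assms
  by (simp add: central_idem_def lin_comb_def group_elt_def if_distrib[of "\<lambda>t. _ * t"] cong: if_cong)

locale block_rep = rat_matrix_rep +
  fixes \<chi> :: "'a \<Rightarrow> complex" and w :: "nat \<Rightarrow> 'a \<Rightarrow> complex" and v :: "nat \<Rightarrow> nat \<Rightarrow> 'a \<Rightarrow> complex"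
  assumes char: "g \<in> carrier G \<Longrightarrow> \<chi> g = of_rat (mat_trace (A g))"
    and indep: "lin_comb {..<n} (\<lambda>i. of_rat (c i)) w = (\<lambda>x. 0) \<Longrightarrow> i < n \<Longrightarrow> c i = 0"
    and act_w: "g \<in> carrier G \<Longrightarrow> j < n \<Longrightarrow>
           conv (group_elt g) (w j) = lin_comb {..<n} (\<lambda>i. of_rat (A g $$ (i, j))) w"
    and v_block: "i < n \<Longrightarrow> j < n \<Longrightarrow> v i j \<in> carrier (block_algebra G \<chi>)"
    and v_w: "i < n \<Longrightarrow> j < n \<Longrightarrow> k < n \<Longrightarrow> conv (v i j) (w k) = (if i = k then w j else (\<lambda>x. 0))"
begin

abbreviation c_idem :: "'a \<Rightarrow> complex" where
  "c_idem \<equiv> central_idem G \<chi>"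

lemma c_idem_central: "conv a c_idem = conv c_idem a"
  by (rule conv_class_function_comm)
     (simp add: central_idem_apply[OF finite_carrier] char mat_trace_rep_comm)

lemma c_idem_rat: "c_idem g \<in> \<rat>"
  by (auto simp: central_idem_apply[OF finite_carrier] char intro!: Rats_mult Rats_divide)

lemma block_carrier:
  "x \<in> carrier (block_algebra G \<chi>) \<longleftrightarrow>
   (\<exists>a. (\<forall>g\<in>carrier G. a g \<in> \<rat>) \<and> (\<forall>g. g \<notin> carrier G \<longrightarrow> a g = 0) \<and> x = conv a c_idem)"
  by (auto simp: block_algebra_def mult_group_algebra) (auto simp: group_algebra_def)

lemma block_rat: "x \<in> carrier (block_algebra G \<chi>) \<Longrightarrow> x g \<in> \<rat>"
  by (auto simp: block_carrier conv_def c_idem_rat intro!: Rats_sum Rats_mult)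

text \<open>A form of Fourier inversion. Traces are rational and agree at inverses, so the
  conjugated character at \<open>inv y \<otimes> x\<close> is the trace of
  \<open>A (inv x) * A y\<close>. Summing over \<open>y\<close> turns each coefficient into a linear
  combination of entries of \<open>rho a\<close>.\<close>

lemma conv_c_idem_eq_zero:
  assumes "\<And>i j. i < n \<Longrightarrow> j < n \<Longrightarrow> rho a i j = 0"
  shows "conv a c_idem = (\<lambda>x. 0)"
proof
  fix x
  show "conv a c_idem x = 0"
  proof (cases "x \<in> carrier G")
    case True
    let ?K = "\<chi> \<one> / of_nat (Coset.order G)"
    have tr: "cnj (\<chi> (inv y \<otimes> x)) =
        (\<Sum>i<n. \<Sum>k<n. of_rat (A (inv x) $$ (i, k)) * of_rat (A y $$ (k, i)))"
      if y: "y \<in> carrier G" for y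
    proof -
      have "inv y \<otimes> x = inv (inv x \<otimes> y)"
        using True y by (simp add: inv_mult_group)
      then have "\<chi> (inv y \<otimes> x) = of_rat (mat_trace (A (inv x \<otimes> y)))"
        using True y by (simp add: char mat_trace_rep_inv)
      also have "mat_trace (A (inv x \<otimes> y)) = (\<Sum>i<n. \<Sum>k<n. A (inv x) $$ (i, k) * A y $$ (k, i))"
        using True y rep_carrier[of "inv x \<otimes> y"] by (simp add: mat_trace_def rep_mult_entry)
      finally show ?thesis
        by (simp add: of_rat_sum of_rat_mult)
    qed
    have "conv a c_idem x = (\<Sum>y\<in>carrier G. a y * (?K * cnj (\<chi> (inv y \<otimes> x))))"
      using True by (simp add: conv_def central_idem_apply[OF finite_carrier])
    also have "\<dots> = (\<Sum>y\<in>carrier G. \<Sum>i<n. \<Sum>k<n.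
        ?K * of_rat (A (inv x) $$ (i, k)) * (a y * of_rat (A y $$ (k, i))))"
      by (intro sum.cong refl) (simp add: tr sum_distrib_left mult_ac)
    also have "\<dots> = (\<Sum>i<n. \<Sum>y\<in>carrier G. \<Sum>k<n.
        ?K * of_rat (A (inv x) $$ (i, k)) * (a y * of_rat (A y $$ (k, i))))"
      by (rule sum.swap)
    also have "\<dots> = (\<Sum>i<n. \<Sum>k<n. \<Sum>y\<in>carrier G.
        ?K * of_rat (A (inv x) $$ (i, k)) * (a y * of_rat (A y $$ (k, i))))"
      by (intro sum.cong refl sum.swap)
    also have "\<dots> = (\<Sum>i<n. \<Sum>k<n. ?K * of_rat (A (inv x) $$ (i, k)) * rho a k i)"
      by (simp add: rho_def sum_distrib_left)
    also have "\<dots> = 0" using assms by simp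
    finally show ?thesis .
  qed (simp add: conv_def)
qed

text \<open>Extends \<open>act_w\<close> by linearity, so that matrices can be read off from actions
  on the \<open>w j\<close>.\<close>

lemma conv_w:
  assumes "j < n"
  shows "conv a (w j) = lin_comb {..<n} (\<lambda>i. rho a i j) w"
proof
  fix x
  have "conv a (w j) x = (\<Sum>g\<in>carrier G. \<Sum>i<n. a g * of_rat (A g $$ (i, j)) * w i x)"
    unfolding conv_as_sum_of_translates[OF finite_carrier, of a]
    using assms by (simp add: act_w lin_comb_def sum_distrib_left mult.assoc)
  also have "\<dots> = lin_comb {..<n} (\<lambda>i. rho a i j) w x"
    unfolding lin_comb_def rho_def sum_distrib_right by (rule sum.swap)
  finally show "conv a (w j) x = lin_comb {..<n} (\<lambda>i. rho a i j) w x" .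
qed

text \<open>As \<open>v i j\<close> sends \<open>w i\<close> to \<open>w j\<close> and kills the
  others, its only nonzero entry lies in row \<open>j\<close> and column \<open>i\<close>. Both
  coefficient vectors \<open>q\<close> and \<open>e\<close> are rational, so \<open>indep\<close>
  compares them.\<close>

lemma rho_v:
  assumes "i < n" "j < n" "l < n" "k < n"
  shows "rho (v i j) l k = (if l = j \<and> i = k then 1 else 0)"
proof -
  have "\<exists>q. rho (v i j) l k = of_rat q" for l
    using rho_rat[of "v i j" l k] block_rat[OF v_block[OF assms(1,2)]] by (auto elim: Rats_cases)
  then obtain q where q: "\<And>l. rho (v i j) l k = of_rat (q l)" by metis
  define e where "e l = (if l = j \<and> i = k then 1 else 0 :: rat)" for l
  have "lin_comb {..<n} (\<lambda>l. of_rat (q l)) w = (if i = k then w j else (\<lambda>x. 0))"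
    using conv_w[of k "v i j"] v_w[of i j k] assms q by simp
  also have "\<dots> = lin_comb {..<n} (\<lambda>l. of_rat (e l)) w"
    using assms by (auto simp: lin_comb_def e_def fun_eq_iff if_distrib[of of_rat]
        if_distrib[of "\<lambda>t. t * _"] cong: if_cong)
  finally have "lin_comb {..<n} (\<lambda>l. of_rat (q l - e l)) w = (\<lambda>x. 0)"
    by (simp add: lin_comb_def of_rat_diff left_diff_distrib sum_subtractf fun_eq_iff)
  from indep[OF this \<open>l < n\<close>] have "q l = e l" by simp
  then show ?thesis using q by (simp add: e_def)
qed

text \<open>Reads off coordinates with respect to the \<open>v i j\<close>; note the swapped
  indices.\<close>

lemma rho_lin_comb_v:
  assumes "i < n" "j < n"
  shows "rho (lin_comb ({..<n} \<times> {..<n}) d (\<lambda>(i, j). v i j)) j i = d (i, j)"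
proof -
  have "rho (lin_comb ({..<n} \<times> {..<n}) d (\<lambda>(i, j). v i j)) j i =
     (\<Sum>t\<in>{..<n} \<times> {..<n}. if t = (i, j) then d t else 0)"
    unfolding rho_lin_comb using assms by (intro sum.cong refl) (auto simp: rho_v split: if_splits)
  then show ?thesis using assms by simp
qed

text \<open>Stands in for a computation of \<open>rho c_idem\<close>. Row \<open>i\<close> of
  \<open>rho a\<close> is row \<open>i\<close> of \<open>rho (conv (v i i) a)\<close>; writing
  \<open>v i i = conv b c_idem\<close> and using centrality, this factors through
  \<open>rho (conv a c_idem)\<close>.\<close>

lemma rho_eq_zero_of_rho_conv_c_idem:
  assumes "\<And>i j. i < n \<Longrightarrow> j < n \<Longrightarrow> rho (conv a c_idem) i j = 0" and "i < n" "j < n"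
  shows "rho a i j = 0"
proof -
  obtain b where b: "v i i = conv b c_idem"
    using v_block[OF \<open>i < n\<close> \<open>i < n\<close>] by (auto simp: block_carrier)
  have "rho a i j = (\<Sum>k<n. rho (v i i) i k * rho a k j)"
    using assms by (simp add: rho_v if_distrib[of "\<lambda>t. t * _"] cong: if_cong)
  also have "\<dots> = rho (conv b (conv a c_idem)) i j"
    using assms by (simp add: rho_conv[symmetric] b conv_assoc c_idem_central[symmetric])
  also have "\<dots> = 0"
    using assms by (simp add: rho_conv)
  finally show ?thesis .
qed

lemma block_basis: "rat_basis ({..<n} \<times> {..<n}) (\<lambda>(i, j). v i j) (carrier (block_algebra G \<chi>))"
proof -
  let ?I = "{..<n} \<times> {..<n}"
  have "\<exists>a. (\<forall>g\<in>carrier G. a g \<in> \<rat>) \<and> (\<forall>g. g \<notin> carrier G \<longrightarrow> a g = 0) \<and>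
          (case t of (i, j) \<Rightarrow> v i j) = conv a c_idem" if t: "t \<in> ?I" for t
  proof -
    obtain i j where "t = (i, j)" "i < n" "j < n" using t by auto
    then show ?thesis
      using v_block[of i j] unfolding block_carrier by simp
  qed
  then have "\<forall>t\<in>?I. \<exists>a. (\<forall>g\<in>carrier G. a g \<in> \<rat>) \<and> (\<forall>g. g \<notin> carrier G \<longrightarrow> a g = 0) \<and>
          (case t of (i, j) \<Rightarrow> v i j) = conv a c_idem"
    by (rule ballI)
  \<comment> \<open>Rational preimages are chosen for all \<open>v i j\<close> at once, so that
    every rational combination of the \<open>v i j\<close> has a rational preimage as well.\<close>
  from bchoice[OF this] obtain b where "\<forall>t\<in>?I. (\<forall>g\<in>carrier G. b t g \<in> \<rat>) \<and>
      (\<forall>g. g \<notin> carrier G \<longrightarrow> b t g = 0) \<and> (case t of (i, j) \<Rightarrow> v i j) = conv (b t) c_idem" ..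
  then have b_rat: "\<And>t g. t \<in> ?I \<Longrightarrow> g \<in> carrier G \<Longrightarrow> b t g \<in> \<rat>"
    and b_supp: "\<And>t g. t \<in> ?I \<Longrightarrow> g \<notin> carrier G \<Longrightarrow> b t g = 0"
    and b: "\<And>t. t \<in> ?I \<Longrightarrow> (case t of (i, j) \<Rightarrow> v i j) = conv (b t) c_idem"
    by blast+
  have lc: "lin_comb ?I d (\<lambda>(i, j). v i j) = conv (lin_comb ?I d b) c_idem" for d
    unfolding conv_lin_comb_left using b by (auto simp: lin_comb_def fun_eq_iff intro!: sum.cong)
  have "lin_comb ?I (\<lambda>t. of_rat (d t)) (\<lambda>(i, j). v i j) \<in> carrier (block_algebra G \<chi>)" for d
    unfolding block_carrier lc
    by (rule exI[of _ "lin_comb ?I (\<lambda>t. of_rat (d t)) b"])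
       (auto simp: lin_comb_def b_supp intro!: Rats_sum Rats_mult b_rat sum.neutral)
  moreover have "\<exists>d. x = lin_comb ?I (\<lambda>t. of_rat (d t)) (\<lambda>(i, j). v i j)"
    if x: "x \<in> carrier (block_algebra G \<chi>)" for x
  proof -
    obtain a where a: "x = conv a c_idem" using x block_carrier by auto
    have "\<exists>q. rho x (snd t) (fst t) = of_rat q" for t
      using rho_rat[of x "snd t" "fst t"] block_rat[OF x] by (auto elim: Rats_cases)
    \<comment> \<open>The candidate coefficient of \<open>v i j\<close> is entry
      \<open>(j, i)\<close> of \<open>rho x\<close>, in line with \<open>rho_v\<close>.\<close>
    then obtain d where d: "\<And>t. rho x (snd t) (fst t) = of_rat (d t)" by metis
    let ?y = "lin_comb ?I (\<lambda>t. of_rat (d t)) (\<lambda>(i, j). v i j)"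
    \<comment> \<open>A preimage of \<open>x - ?y\<close> under multiplication by
      \<open>c_idem\<close>. Vanishing of \<open>rho\<close> on the product passes to
      \<open>?a\<close>, and this in turn kills the product itself.\<close>
    let ?a = "\<lambda>g. a g - lin_comb ?I (\<lambda>t. of_rat (d t)) b g"
    have xy: "conv ?a c_idem = (\<lambda>g. x g - ?y g)"
      by (simp add: lc a conv_def fun_eq_iff left_diff_distrib sum_subtractf)
    have "rho (conv ?a c_idem) i j = 0" if "i < n" "j < n" for i j
    proof -
      have "rho (conv ?a c_idem) i j = rho x i j - rho ?y i j"
        by (simp add: xy rho_def left_diff_distrib sum_subtractf)
      also have "\<dots> = 0"
        using that d[of "(j, i)"] by (simp add: rho_lin_comb_v)
      finally show ?thesis .
    qed
    then have "conv ?a c_idem = (\<lambda>g. 0)"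
      using conv_c_idem_eq_zero[of ?a, OF rho_eq_zero_of_rho_conv_c_idem[of ?a]] by simp
    then have "x = ?y" by (simp add: xy fun_eq_iff)
    then show ?thesis by blast
  qed
  moreover have "d t = 0"
    if z: "lin_comb ?I (\<lambda>t. of_rat (d t)) (\<lambda>(i, j). v i j) = (\<lambda>x. 0)" and t: "t \<in> ?I"
    for d :: "nat \<times> nat \<Rightarrow> rat" and t
  proof -
    obtain i j where ij: "t = (i, j)" "i < n" "j < n" using t by auto
    show ?thesis
      using rho_lin_comb_v[OF ij(2,3), of "\<lambda>t. of_rat (d t)"] ij(1) by (simp add: z rho_def)
  qed
  ultimately show ?thesis
    unfolding rat_basis_def by blast
qed

lemma conv_eq_zero_iff:
  assumes "M = conv M c_idem"
  shows "conv M t = (\<lambda>x. 0) \<longleftrightarrow> (\<forall>i<n. \<forall>j<n. (\<Sum>k<n. rho M i k * rho t k j) = 0)"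
proof
  assume "conv M t = (\<lambda>x. 0)"
  then show "\<forall>i<n. \<forall>j<n. (\<Sum>k<n. rho M i k * rho t k j) = 0"
    by (auto simp: rho_conv[symmetric]) (simp add: rho_def)
next
  assume *: "\<forall>i<n. \<forall>j<n. (\<Sum>k<n. rho M i k * rho t k j) = 0"
  \<comment> \<open>The factor \<open>c_idem\<close> of \<open>M\<close> moves past \<open>t\<close>
    by centrality.\<close>
  have "conv M t = conv (conv M t) c_idem"
    by (subst assms) (simp add: conv_assoc c_idem_central)
  also have "\<dots> = (\<lambda>x. 0)"
    by (rule conv_c_idem_eq_zero) (use * in \<open>simp add: rho_conv\<close>)
  finally show "conv M t = (\<lambda>x. 0)" .
qed

end


section \<open>Automorphisms over the rationals\<close>

lemma field_auts_subgroup: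
  assumes "\<And>x y. x \<in> K \<Longrightarrow> y \<in> K \<Longrightarrow> x + y \<in> K \<and> x * y \<in> K" and "\<rat> \<subseteq> K"
  shows "subgroup (field_auts K) (BijGroup K)"
proof
  show "field_auts K \<subseteq> carrier (BijGroup K)"
    by (auto simp: field_auts_def BijGroup_def)
  show "\<one>\<^bsub>BijGroup K\<^esub> \<in> field_auts K"
    using assms by (auto simp: field_auts_def BijGroup_def id_Bij)
  fix s assume s: "s \<in> field_auts K"
  then have sB: "s \<in> Bij K" by (simp add: field_auts_def)
  have "inv_into K s (x + y) = inv_into K s x + inv_into K s y"
    "inv_into K s (x * y) = inv_into K s x * inv_into K s y" if "x \<in> K" "y \<in> K" for x y
    using s assms that by (auto simp: field_auts_def intro!: Bij_inv_into_lemma[of K s])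
  moreover have "inv_into K s q = q" if "q \<in> \<rat>" for q
    using s assms(2) that
    by (intro inv_into_f_eq) (auto simp: field_auts_def Bij_def bij_betw_def)
  ultimately show "inv\<^bsub>BijGroup K\<^esub> s \<in> field_auts K"
    using assms sB restrict_inv_into_Bij[OF sB] by (auto simp: inv_BijGroup field_auts_def)
  fix t assume t: "t \<in> field_auts K"
  have fun_K: "\<And>u x. u \<in> field_auts K \<Longrightarrow> x \<in> K \<Longrightarrow> u x \<in> K"
    using Bij_imp_funcset by (fastforce simp: field_auts_def)
  show "s \<otimes>\<^bsub>BijGroup K\<^esub> t \<in> field_auts K"
    using s t assms fun_K[OF t] compose_Bij[of s K t]
    by (auto simp: field_auts_def BijGroup_def compose_def)
qed

text \<open>The maps in \<open>Bij K\<close> are \<open>undefined\<close> outside \<open>K\<close>.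
  These closure properties keep sums with rational coefficients inside \<open>K\<close>, where
  automorphisms act termwise.\<close>

locale rat_aut_group =
  fixes K :: "complex set"
  assumes add_closed: "x \<in> K \<Longrightarrow> y \<in> K \<Longrightarrow> x + y \<in> K"
    and mult_closed: "x \<in> K \<Longrightarrow> y \<in> K \<Longrightarrow> x * y \<in> K"
    and rat_subset: "\<rat> \<subseteq> K"
begin

lemma sum_closed:
  assumes "\<And>i. i \<in> I \<Longrightarrow> f i \<in> K"
  shows "sum f I \<in> K"
  using assms rat_subset by (induction I rule: infinite_finite_induct) (auto intro: add_closed)

lemma group_galois_group: "group (galois_group K)"
  unfolding galois_group_def
  by (intro subgroup.subgroup_is_group field_auts_subgroup group_BijGroup)
     (auto intro: add_closed mult_closed rat_subset[THEN subsetD])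

lemma aut_closed: "s \<in> carrier (galois_group K) \<Longrightarrow> x \<in> K \<Longrightarrow> s x \<in> K"
  using Bij_imp_funcset by (fastforce simp: galois_group_def field_auts_def)

lemma aut_mult_apply:
  "s \<in> carrier (galois_group K) \<Longrightarrow> t \<in> carrier (galois_group K) \<Longrightarrow> x \<in> K \<Longrightarrow>
   (s \<otimes>\<^bsub>galois_group K\<^esub> t) x = s (t x)"
  by (simp add: galois_group_def field_auts_def BijGroup_def compose_def)

lemma aut_rat_mult:
  assumes "s \<in> carrier (galois_group K)" "x \<in> K"
  shows "s (of_rat q * x) = of_rat q * s x"
  using assms subsetD[OF rat_subset Rats_of_rat[of q]]
  by (simp add: galois_group_def field_auts_def)

lemma aut_sum:
  assumes "s \<in> carrier (galois_group K)" "\<And>i. i \<in> I \<Longrightarrow> f i \<in> K"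
  shows "s (sum f I) = (\<Sum>i\<in>I. s (f i))"
  using assms(2)
proof (induction I rule: infinite_finite_induct)
  case (insert i I)
  then show ?case
    using assms(1) by (auto simp: galois_group_def field_auts_def sum_closed)
\<comment> \<open>Empty and infinite sums are 0, which is rational and hence fixed.\<close>
qed (use assms(1) in \<open>auto simp: galois_group_def field_auts_def\<close>)

end

lemma rat_aut_group_adjoin_rat: "rat_aut_group (adjoin_rat \<alpha>)"
proof
  fix x y assume "x \<in> adjoin_rat \<alpha>" "y \<in> adjoin_rat \<alpha>"
  then show "x + y \<in> adjoin_rat \<alpha>" "x * y \<in> adjoin_rat \<alpha>"
    using generate_field.eng_add[of x class_ring _ y] generate_field.eng_mult[of x class_ring _ y]
    by (auto simp: adjoin_rat_def)
qed (auto simp: adjoin_rat_def intro: generate_field.incl)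

lemma in_adjoin_rat: "\<alpha> \<in> adjoin_rat \<alpha>"
  by (auto simp: adjoin_rat_def intro: generate_field.incl)

section \<open>The Galois action on the matrix of conjugates\<close>

locale galois_block_rep = rat_aut_group K + block_rep "galois_group K" n A \<chi> w v
  for K n A \<chi> w v +
  fixes \<alpha> :: complex
  assumes \<alpha>_mem: "\<alpha> \<in> K"
begin

text \<open>The coefficient function of \<open>\<theta>\<close>; only its values on the group are
  read.\<close>

abbreviation conj_elt :: "(complex \<Rightarrow> complex) \<Rightarrow> complex" where
  "conj_elt \<equiv> \<lambda>g. (inv\<^bsub>galois_group K\<^esub> g) \<alpha>"

text \<open>Replacing \<open>g\<close> by \<open>g \<otimes> h\<close> absorbs the automorphism,
  since \<open>h \<otimes> inv (g \<otimes> h) = inv g\<close>, and leaves a factor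
  \<open>A h\<close> on the right.\<close>

lemma aut_rho_conj_elt:
  assumes h: "h \<in> carrier (galois_group K)" and "i < n" "j < n"
  shows "h (rho conj_elt i j) = (\<Sum>k<n. rho conj_elt i k * of_rat (A h $$ (k, j)))"
proof -
  let ?G = "galois_group K"
  have mem: "conj_elt g \<in> K" if "g \<in> carrier ?G" for g
    using that \<alpha>_mem by (simp add: aut_closed)
  have "rho conj_elt i j = (\<Sum>g\<in>carrier ?G. of_rat (A g $$ (i, j)) * conj_elt g)"
    by (simp add: rho_def mult.commute)
  also have "h \<dots> = (\<Sum>g\<in>carrier ?G. of_rat (A g $$ (i, j)) * h (conj_elt g))"
    using h rat_subset
    by (subst aut_sum) (auto simp: aut_rat_mult mem intro!: mult_closed)
  also have "\<dots> = (\<Sum>g\<in>carrier ?G. of_rat (A (g \<otimes>\<^bsub>?G\<^esub> h) $$ (i, j)) *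
                      h (conj_elt (g \<otimes>\<^bsub>?G\<^esub> h)))"
    by (rule sum_right_translate[OF h, symmetric])
  also have "\<dots> = (\<Sum>g\<in>carrier ?G. of_rat (A (g \<otimes>\<^bsub>?G\<^esub> h) $$ (i, j)) * conj_elt g)"
  proof (intro sum.cong refl arg_cong2[of _ _ _ _ "(*)"])
    fix g assume g: "g \<in> carrier ?G"
    have "h (conj_elt (g \<otimes>\<^bsub>?G\<^esub> h)) = (h \<otimes>\<^bsub>?G\<^esub> inv\<^bsub>?G\<^esub> (g \<otimes>\<^bsub>?G\<^esub> h)) \<alpha>"
      using g h \<alpha>_mem by (subst aut_mult_apply) auto
    also have "h \<otimes>\<^bsub>?G\<^esub> inv\<^bsub>?G\<^esub> (g \<otimes>\<^bsub>?G\<^esub> h) = inv\<^bsub>?G\<^esub> g"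
      using g h by (simp add: inv_mult_group m_assoc[symmetric])
    finally show "h (conj_elt (g \<otimes>\<^bsub>?G\<^esub> h)) = conj_elt g" .
  qed
  also have "\<dots> = (\<Sum>g\<in>carrier ?G. \<Sum>k<n. conj_elt g * of_rat (A g $$ (i, k)) * of_rat (A h $$ (k, j)))"
    using h assms by (intro sum.cong refl)
      (simp add: rep_mult_entry of_rat_sum of_rat_mult sum_distrib_left sum_distrib_right mult_ac)
  also have "\<dots> = (\<Sum>k<n. \<Sum>g\<in>carrier ?G. conj_elt g * of_rat (A g $$ (i, k)) * of_rat (A h $$ (k, j)))"
    by (rule sum.swap)
  also have "\<dots> = (\<Sum>k<n. rho conj_elt i k * of_rat (A h $$ (k, j)))"
    by (simp add: rho_def sum_distrib_right)
  finally show ?thesis .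
qed

text \<open>
  Applying \<open>h \<in> G\<close> to the vanishing first column kills \<open>A(h) e\<^sub>0\<close>, and \<open>v\<^sub>0\<^sub>j\<close> writes \<open>e\<^sub>j\<close> as a
  combination of these vectors.
\<close>

lemma first_column_suffices:
  fixes r :: "nat \<Rightarrow> rat"
  assumes col0: "(\<Sum>k<n. of_rat (r k) * rho conj_elt k 0) = 0" and j: "j < n"
  shows "(\<Sum>k<n. of_rat (r k) * rho conj_elt k j) = 0"
proof -
  let ?G = "galois_group K"
  let ?T = "\<lambda>l. \<Sum>k<n. of_rat (r k) * rho conj_elt k l"
  have n: "0 < n" using j by simp
  have rat_mem: "of_rat q \<in> K" for q
    using rat_subset by auto
  have mem: "rho conj_elt k l \<in> K" for k l
    unfolding rho_def
    by (rule sum_closed, rule mult_closed) (simp_all add: rat_mem aut_closed \<alpha>_mem)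
  have eq0: "(\<Sum>l<n. ?T l * of_rat (A h $$ (l, 0))) = 0" if h: "h \<in> carrier ?G" for h
  proof -
    have "h 0 = 0"
      using h by (simp add: galois_group_def field_auts_def)
    then have "0 = h (?T 0)" by (simp add: col0)
    \<comment> \<open>Rationality of \<open>r\<close> is essential: \<open>h\<close> fixes its
      entries.\<close>
    also have "\<dots> = (\<Sum>k<n. of_rat (r k) * h (rho conj_elt k 0))"
      using h by (subst aut_sum) (auto simp: aut_rat_mult mem rat_mem intro!: mult_closed)
    also have "\<dots> = (\<Sum>k<n. \<Sum>l<n. of_rat (r k) * rho conj_elt k l * of_rat (A h $$ (l, 0)))"
      using h n by (simp add: aut_rho_conj_elt sum_distrib_left mult_ac)
    also have "\<dots> = (\<Sum>l<n. ?T l * of_rat (A h $$ (l, 0)))"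
      by (subst sum.swap) (simp add: sum_distrib_right)
    finally show ?thesis by simp
  qed
  \<comment> \<open>Column 0 of \<open>rho (v 0 j)\<close> is the unit vector at \<open>j\<close>;
    unfolding \<open>rho\<close> expresses it through the first columns of the
    \<open>A h\<close>.\<close>
  have "?T j = (\<Sum>l<n. ?T l * rho (v 0 j) l 0)"
    using n j by (simp add: rho_v if_distrib[of "\<lambda>t. _ * t"] cong: if_cong)
  also have "\<dots> = (\<Sum>l<n. \<Sum>h\<in>carrier ?G. v 0 j h * (?T l * of_rat (A h $$ (l, 0))))"
    unfolding rho_def[of "v 0 j"] sum_distrib_left[of "?T _"] by (simp add: mult_ac)
  also have "\<dots> = (\<Sum>h\<in>carrier ?G. v 0 j h * (\<Sum>l<n. ?T l * of_rat (A h $$ (l, 0))))"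
    by (subst sum.swap) (simp add: sum_distrib_left[of "v 0 j _"])
  also have "\<dots> = 0" by (simp add: eq0)
  finally show ?thesis .
qed

end

section \<open>From the hypotheses of the theorem to the locales, and the conclusion\<close>

text \<open>
  For infinite \<open>G\<close> all sums over \<open>carrier G\<close> are zero by convention, which makes the block algebra zero.
\<close>

lemma finite_of_block_ideal:
  assumes "group G" and "minimal_left_ideal I (block_algebra G \<chi>)"
  shows "finite (carrier G)"
proof (rule ccontr)
  assume inf: "infinite (carrier G)"
  interpret group G by fact
  have "carrier (block_algebra G \<chi>) \<subseteq> {\<lambda>x. 0}"
    using inf by (auto simp: block_algebra_def group_algebra_def)
  moreover have "subgroup I (add_monoid (block_algebra G \<chi>))" "I \<noteq> {\<lambda>x. 0}"
    using assms(2)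
    by (auto simp: minimal_left_ideal_def left_ideal_def additive_subgroup_def block_algebra_def
        group_algebra_def)
  ultimately show False
    using subgroup.subset[of I "add_monoid (block_algebra G \<chi>)"]
      subgroup.one_closed[of I "add_monoid (block_algebra G \<chi>)"] by auto
qed

lemma rat_matrix_rep_of_hom:
  assumes "group G" and "finite (carrier G)" and A: "A \<in> hom G (GL n)"
  shows "rat_matrix_rep G n A"
proof -
  interpret group G by fact
  interpret R: ring "ring_mat TYPE(rat) n ()" by (rule ring_mat)
  have "group (GL n :: rat mat monoid)"
    unfolding GL_def by (rule R.units_group)
  from hom_one[OF A \<open>group G\<close> this] have "A \<one>\<^bsub>G\<^esub> = 1\<^sub>m n"
    by (simp add: GL_def units_of_def ring_mat_simps)
  then show ?thesis
    using A assms(2)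
    by unfold_locales (auto simp: hom_def Pi_def GL_def units_of_def ring_mat_simps Units_def)
qed

theorem theorem3p2:
  fixes f :: "int poly" and \<alpha> :: complex
    and G :: "(complex \<Rightarrow> complex) monoid"
    and \<chi> :: "(complex \<Rightarrow> complex) \<Rightarrow> complex"
    and n :: nat
    and A :: "(complex \<Rightarrow> complex) \<Rightarrow> rat mat"
    and \<mm> :: "((complex \<Rightarrow> complex) \<Rightarrow> complex) set"
    and w :: "nat \<Rightarrow> (complex \<Rightarrow> complex) \<Rightarrow> complex"
    and v :: "nat \<Rightarrow> nat \<Rightarrow> (complex \<Rightarrow> complex) \<Rightarrow> complex"
    and M :: "(complex \<Rightarrow> complex) \<Rightarrow> complex"
    and m :: "rat mat"
  assumes "lead_coeff f = 1" and "irreducible f"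
    and "poly (map_poly of_int f) \<alpha> = 0"
    and "galois_over_rat (adjoin_rat \<alpha>)"
    and "G = galois_group (adjoin_rat \<alpha>)"
    and "absolutely_irreducible_character G \<chi>"
    and "\<chi> \<one>\<^bsub>G\<^esub> = of_nat n"
    and "A \<in> hom G (GL n)"
    and "\<forall>g \<in> carrier G. \<chi> g = of_rat (mat_trace (A g))"
    and "minimal_left_ideal \<mm> (block_algebra G \<chi>)"
    and "rat_basis {..<n} w \<mm>"
    and "\<forall>g \<in> carrier G. \<forall>j<n.
           group_elt g \<otimes>\<^bsub>rat_group_algebra G\<^esub> w j = lin_comb {..<n} (\<lambda>i. of_rat (A g $$ (i, j))) w"
    and "\<forall>i<n. \<forall>j<n. v i j \<in> carrier (block_algebra G \<chi>)"
    and "\<forall>i<n. \<forall>j<n. \<forall>k<n.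
           v i j \<otimes>\<^bsub>rat_group_algebra G\<^esub> w k = (if i = k then w j else \<zero>\<^bsub>rat_group_algebra G\<^esub>)"
    and "M \<in> carrier (rat_group_algebra G)"
    and "M = M \<otimes>\<^bsub>rat_group_algebra G\<^esub> central_idem G \<chi>"
    and "m \<in> carrier_mat n n"
    and "M = lin_comb ({..<n} \<times> {..<n}) (\<lambda>(k, l). of_rat (m $$ (k, l))) (\<lambda>(k, l). v l k)"
  shows "rat_basis ({..<n} \<times> {..<n}) (\<lambda>(i, j). v i j) (carrier (block_algebra G \<chi>)) \<and>
         (M \<in> LR G \<alpha> \<chi> \<longleftrightarrow> map_mat of_rat m * conjugate_sum_mat G \<alpha> n A = 0\<^sub>m n n) \<and>
         (map_mat of_rat m * conjugate_sum_mat G \<alpha> n A = 0\<^sub>m n n \<longleftrightarrow>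
          map_mat of_rat m *\<^sub>v col (conjugate_sum_mat G \<alpha> n A) 0 = 0\<^sub>v n)"
proof -
  let ?K = "adjoin_rat \<alpha>"
  have gr: "group G"
    using assms(5) rat_aut_group.group_galois_group[OF rat_aut_group_adjoin_rat] by simp
  note alg_mult = group.mult_group_algebra[OF gr]
  have fin: "finite (carrier G)"
    by (rule finite_of_block_ideal[OF gr assms(10)])
  have "block_rep G n A \<chi> w v"
  proof (intro block_rep.intro block_rep_axioms.intro rat_matrix_rep_of_hom[OF gr fin assms(8)])
    show "c i = 0" if "lin_comb {..<n} (\<lambda>i. of_rat (c i)) w = (\<lambda>x. 0)" "i < n"
      for c :: "nat \<Rightarrow> rat" and i
      using assms(11) that by (simp add: rat_basis_def)
    show "group.conv G (v i j) (w k) = (if i = k then w j else (\<lambda>x. 0))"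
      if "i < n" "j < n" "k < n" for i j k
      using assms(14) that by (simp add: alg_mult) (simp add: group_algebra_def)
  qed (use assms(9,12,13) in \<open>auto simp: alg_mult\<close>)
  then interpret galois_block_rep ?K n A \<chi> w v \<alpha>
    unfolding assms(5)
    by (intro galois_block_rep.intro galois_block_rep_axioms.intro rat_aut_group_adjoin_rat
        in_adjoin_rat)
  note [simp] = assms(5)
  let ?N = "map_mat of_rat m :: complex mat"
  let ?C = "conjugate_sum_mat G \<alpha> n A"
  have C_carrier: "?C \<in> carrier_mat n n"
    by (simp add: conjugate_sum_mat_def)
  have C: "?C $$ (i, j) = rho conj_elt i j" if "i < n" "j < n" for i j
    using that by (simp add: conjugate_sum_mat_def rho_def)
  have NC: "(?N * ?C) $$ (i, j) = (\<Sum>k<n. of_rat (m $$ (i, k)) * rho conj_elt k j)"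
    if "i < n" "j < n" for i j
    using that assms(17) C C_carrier by (subst mult_mat_entry[of _ n]) auto
  have NC_zero: "?N * ?C = 0\<^sub>m n n \<longleftrightarrow>
      (\<forall>i<n. \<forall>j<n. (\<Sum>k<n. of_rat (m $$ (i, k)) * rho conj_elt k j) = 0)"
    using assms(17) C_carrier NC by (auto simp: mat_eq_iff simp del: index_mult_mat(1))
  have "?N *\<^sub>v col ?C 0 = 0\<^sub>v n \<longleftrightarrow>
      (\<forall>i<n. (\<Sum>k<n. of_rat (m $$ (i, k)) * rho conj_elt k 0) = 0)"
  proof -
    have "(?N *\<^sub>v col ?C 0) $ i = (?N * ?C) $$ (i, 0)" if "i < n" for i
      using that assms(17) C_carrier by simp
    then show ?thesis
      using assms(17) NC by (auto simp: vec_eq_iff simp del: index_mult_mat(1) index_mult_mat_vec)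
  qed
  \<comment> \<open>Each row of \<open>m\<close> is rational, so
    \<open>first_column_suffices\<close> applies row by row; the converse takes column 0.\<close>
  then have col: "?N * ?C = 0\<^sub>m n n \<longleftrightarrow> ?N *\<^sub>v col ?C 0 = 0\<^sub>v n"
    unfolding NC_zero by (auto intro: first_column_suffices)
  \<comment> \<open>Swapping the index pair matches the enumeration of the basis; as
    \<open>rho_v\<close> swaps too, \<open>rho M\<close> is \<open>m\<close> and not its
    transpose.\<close>
  have M: "M = lin_comb ({..<n} \<times> {..<n}) (\<lambda>(l, k). of_rat (m $$ (k, l))) (\<lambda>(i, j). v i j)"
    unfolding assms(18) lin_comb_def
    by (intro ext sum.reindex_bij_witness[of _ prod.swap prod.swap]) auto
  have rho_M: "rho M i j = of_rat (m $$ (i, j))" if "i < n" "j < n" for i j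
    using that by (subst M) (simp add: rho_lin_comb_v)
  \<comment> \<open>At \<open>x\<close> only the summand with \<open>g = inv x\<close> survives, so
    the element in \<open>LR\<close> has the coefficients \<open>conj_elt\<close>.\<close>
  have theta: "lin_comb (carrier G) (\<lambda>g. g \<alpha>) (\<lambda>g. group_elt (inv\<^bsub>G\<^esub> g)) x = conj_elt x"
    if x: "x \<in> carrier G" for x
  proof -
    have "x = inv\<^bsub>G\<^esub> g \<longleftrightarrow> g = inv\<^bsub>G\<^esub> x" if "g \<in> carrier G" for g
      using x that by auto
    then have "lin_comb (carrier G) (\<lambda>g. g \<alpha>) (\<lambda>g. group_elt (inv\<^bsub>G\<^esub> g)) x =
        (\<Sum>g\<in>carrier G. if g = inv\<^bsub>G\<^esub> x then g \<alpha> else 0)"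
      unfolding lin_comb_def group_elt_def by (intro sum.cong refl) auto
    then show ?thesis using x fin by simp
  qed
  have Mc: "M = conv M c_idem"
    using assms(16) by (simp add: mult_group_algebra)
  have "M \<in> LR G \<alpha> \<chi> \<longleftrightarrow>
      conv M (lin_comb (carrier G) (\<lambda>g. g \<alpha>) (\<lambda>g. group_elt (inv\<^bsub>G\<^esub> g))) = (\<lambda>x. 0)"
    using assms(15) Mc by (simp add: LR_def mult_group_algebra) (simp add: group_algebra_def)
  also have "\<dots> \<longleftrightarrow> (\<forall>i<n. \<forall>j<n. (\<Sum>k<n. of_rat (m $$ (i, k)) * rho conj_elt k j) = 0)"
  proof -
    have "rho (lin_comb (carrier G) (\<lambda>g. g \<alpha>) (\<lambda>g. group_elt (inv\<^bsub>G\<^esub> g))) k j = rho conj_elt k j"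
      for k j
      using theta by (simp add: rho_def)
    then show ?thesis
      unfolding conv_eq_zero_iff[OF Mc] by (simp add: rho_M)
  qed
  finally show ?thesis
    using block_basis col NC_zero by simp
qed

end
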